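(* Let $a$ be an odd integer, let $k,m$ be positive integers with $m\ge 5$, and let $b\in\{1,3,5,\ldots\}$. Then $$\begin{aligned}E_{2^mk+b}^{(a)}-E_b^{(a)}\equiv{}& 2^mk\{(17a^7+162a^5+153a^3+64a^2+180a+192)b^2\\&-(102a^7+216a^5+386a^3-704a)b\\&-(211a^7-10a^5-32a^4+66a^3-267a-224)\\&+2^{m+1}(a^2-1)\}\pmod{2^{m+10}}.\end{aligned}$$
   Context: For a nonzero integer $a$, the sequence $\{E_n^{(a)}\}_{n\ge 0}$ is the sequence of integers defined recursively by $$\sum_{j=0}^{\lfloor n/2\rfloor}\binom{n}{2j}a^{2j}E_{n-2j}^{(a)}=(1-a)^n\quad(n=0,1,2,\ldots).$$ *)

theory Defs
  imports Complex_Main "HOL-Number_Theory.Cong"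
begin

text \<open>
  The numbers \<open>E\<^sub>n\<^sup>(\<^sup>a\<^sup>)\<close> are given by the implicit recursion
  \<open>\<Sum>j\<le>n div 2. (n choose (2*j)) * a^(2*j) * E (n - 2*j) = (1 - a)^n\<close>. The coefficient of the
  \<open>j = 0\<close> term is 1, so solving for that term gives the equation below; the two lemmas after it
  show that the function satisfies the implicit recursion and is its only solution.
  The definition makes sense for \<open>a = 0\<close> too.
\<close>

function gen_euler :: "int \<Rightarrow> nat \<Rightarrow> int" where
  "gen_euler a n =
     (1 - a) ^ n
     - (\<Sum>j\<in>{1..n div 2}. int (n choose (2 * j)) * a ^ (2 * j) * gen_euler a (n - 2 * j))"
  by pat_completeness auto
termination
  by (relation "measure snd") auto

declare gen_euler.simps [simp del]

lemma gen_euler_recursion: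
  "(\<Sum>j = 0..n div 2. int (n choose (2 * j)) * a ^ (2 * j) * gen_euler a (n - 2 * j)) = (1 - a) ^ n"
  by (simp add: sum.atLeast_Suc_atMost gen_euler.simps [of a n])

lemma gen_euler_unique:
  assumes "\<And>n. (\<Sum>j = 0..n div 2. int (n choose (2 * j)) * a ^ (2 * j) * f (n - 2 * j)) = (1 - a) ^ n"
  shows "f n = gen_euler a n"
proof (induction n rule: less_induct)
  case (less n)
  have "f n = (1 - a) ^ n
     - (\<Sum>j\<in>{1..n div 2}. int (n choose (2 * j)) * a ^ (2 * j) * f (n - 2 * j))"
    using assms [of n] by (simp add: sum.atLeast_Suc_atMost)
  also have "(\<Sum>j\<in>{1..n div 2}. int (n choose (2 * j)) * a ^ (2 * j) * f (n - 2 * j))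
     = (\<Sum>j\<in>{1..n div 2}. int (n choose (2 * j)) * a ^ (2 * j) * gen_euler a (n - 2 * j))"
    by (rule sum.cong) (auto simp: less)
  finally show ?case
    by (simp add: gen_euler.simps [of a n])
qed

end

theory Submission
  imports Defs "HOL-Computational_Algebra.Polynomial"
begin

text \<open>
  Let \<open>L\<close> be the linear functional on \<open>\<int>[x]\<close> sending \<open>x\<^sup>n\<close> to \<open>E\<^sub>n\<^sup>(\<^sup>a\<^sup>)\<close>. The recursion says
  \<open>L(q(x + 2a)) + L(q(x)) = 2q(1)\<close>, and this determines \<open>L\<close>. Comparing with the functional of
  \<open>a = 1\<close>, which kills odd polynomials, one sees that \<open>2\<^sup>e\<close> dividing an odd polynomial \<open>p\<close> at all
  odd integers implies \<open>2\<^sup>e\<^sup>+\<^sup>1\<close> divides \<open>L(p)\<close>. With \<open>w = x\<^sup>2 - 1\<close>, which is divisible by 8 at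
  odd integers, and \<open>N = 2\<^sup>m\<^sup>-\<^sup>1k\<close>, the difference in question is
  \<open>L(x\<^sup>b((1 + w)\<^sup>N - 1)) = \<Sum>\<^sub>i\<^sub>\<ge>\<^sub>1 (N choose i) L(x\<^sup>bw\<^sup>i)\<close>; the terms with \<open>i \<ge> 4\<close> vanish modulo
  \<open>2\<^sup>m\<^sup>+\<^sup>1\<^sup>0\<close>, and expanding \<open>x\<^sup>b = x(1 + w)\<^sup>h\<close> for \<open>b = 2h + 1\<close> leaves \<open>L(xw)\<close>, \<open>L(xw\<^sup>2)\<close> and
  \<open>L(xw\<^sup>3)\<close>, which are explicit.
\<close>

section \<open>Linear functionals on integer polynomials\<close>

definition umbral :: "(nat \<Rightarrow> int) \<Rightarrow> int poly \<Rightarrow> int" where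
  "umbral f p = (\<Sum>i\<le>degree p. coeff p i * f i)"

lemma umbral_eq_sum:
  assumes "degree p \<le> n"
  shows "umbral f p = (\<Sum>i\<le>n. coeff p i * f i)"
  unfolding umbral_def
  by (rule sum.mono_neutral_left) (use assms in \<open>auto simp: coeff_eq_0\<close>)

lemma umbral_0 [simp]: "umbral f 0 = 0"
  by (simp add: umbral_def)

lemma umbral_add: "umbral f (p + q) = umbral f p + umbral f q"
proof -
  let ?n = "max (degree p) (degree q)"
  show ?thesis
    by (simp add: umbral_eq_sum [of _ ?n] degree_add_le sum.distrib distrib_right)
qed

lemma umbral_smult: "umbral f (smult c p) = c * umbral f p"
  by (simp add: umbral_eq_sum [of "smult c p" "degree p"] umbral_def sum_distrib_left mult.assoc)

lemma umbral_sum: "umbral f (\<Sum>i\<in>A. g i) = (\<Sum>i\<in>A. umbral f (g i))"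
  by (induction A rule: infinite_finite_induct) (simp_all add: umbral_add)

lemma umbral_power: "umbral f ([:0, 1:] ^ n) = f n"
proof -
  have "umbral f (monom 1 n) = (\<Sum>i\<le>n. (if i = n then f i else 0))"
    by (simp add: umbral_eq_sum [of "monom 1 n" n] degree_monom_eq if_distrib [of "\<lambda>x. x * _"] cong: if_cong)
  then show ?thesis by (simp add: monom_altdef)
qed

text \<open>The powers of x span, so values on them fix a linear functional. This is how expressions
  built from shifts and evaluations are identified.\<close>

lemma additive_eq_umbral:
  fixes F :: "int poly \<Rightarrow> int"
  assumes add: "\<And>p q. F (p + q) = F p + F q"
    and smult: "\<And>c p. F (smult c p) = c * F p"
    and power: "\<And>n. F ([:0, 1:] ^ n) = f n"
  shows "F p = umbral f p"
proof -
  have zero: "F 0 = 0" using smult [of 0 0] by simp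
  have F_sum: "F (\<Sum>i\<in>A. g i) = (\<Sum>i\<in>A. F (g i))" for A and g :: "nat \<Rightarrow> int poly"
    by (induction A rule: infinite_finite_induct) (simp_all add: add zero)
  have "F p = F (\<Sum>i\<le>degree p. smult (coeff p i) ([:0, 1:] ^ i))"
    using poly_as_sum_of_monoms [of p] by (simp add: monom_altdef)
  also have "\<dots> = umbral f p"
    by (simp add: F_sum smult power umbral_def)
  finally show ?thesis .
qed

lemma umbral_linear_power:
  "umbral f ([:c, 1:] ^ n) = (\<Sum>i\<le>n. int (n choose i) * c ^ (n - i) * f i)"
proof -
  have "degree ([:c, 1:] ^ n) \<le> n"
    using degree_power_le [of "[:c, 1:]" n] by simp
  then show ?thesis
    by (simp add: umbral_eq_sum coeff_linear_poly_power)
qed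

lemma umbral_pCons: "umbral f (pCons c p) = c * f 0 + umbral (\<lambda>n. f (Suc n)) p"
proof -
  have "degree (pCons c p) \<le> Suc (degree p)" by (rule degree_pCons_le)
  then show ?thesis
    by (simp add: umbral_eq_sum sum.atMost_Suc_shift umbral_def del: sum.atMost_Suc)
qed

section \<open>The shift equation and its unique solution\<close>

text \<open>Odd powers of \<open>a\<close> cancel between the two shifts and even ones double, which
  produces the left side of the defining recursion.\<close>

lemma umbral_power_shift_symmetric:
  "umbral f ([:a, 1:] ^ n) + umbral f ([:- a, 1:] ^ n) =
   2 * (\<Sum>j = 0..n div 2. int (n choose (2 * j)) * a ^ (2 * j) * f (n - 2 * j))"
proof -
  define g where "g i = int (n choose i) * (a ^ i + (- a) ^ i) * f (n - i)" for i
  have "umbral f ([:a, 1:] ^ n) + umbral f ([:- a, 1:] ^ n) =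
      (\<Sum>i\<le>n. int (n choose i) * (a ^ (n - i) + (- a) ^ (n - i)) * f i)"
    by (simp add: umbral_linear_power sum.distrib [symmetric] algebra_simps)
  also have "\<dots> = (\<Sum>i\<le>n. g i)"
    by (rule sum.reindex_bij_witness [of _ "\<lambda>i. n - i" "\<lambda>i. n - i"])
       (auto simp: g_def binomial_symmetric [symmetric])
  also have "\<dots> = (\<Sum>i\<in>(\<lambda>j. 2 * j) ` {0..n div 2}. g i)"
  proof (rule sum.mono_neutral_right)
    show "\<forall>i\<in>{..n} - (\<lambda>j. 2 * j) ` {0..n div 2}. g i = 0"
    proof
      fix i assume i: "i \<in> {..n} - (\<lambda>j. 2 * j) ` {0..n div 2}"
      have "odd i"
      proof
        assume "even i"
        then have "i = 2 * (i div 2)" "i div 2 \<in> {0..n div 2}"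
          using i by (auto simp: div_le_mono)
        then show False using i by blast
      qed
      then show "g i = 0" by (simp add: g_def)
    qed
  qed auto
  also have "\<dots> = (\<Sum>j = 0..n div 2. g (2 * j))"
    by (subst sum.reindex) (auto simp: inj_on_def)
  also have "\<dots> = 2 * (\<Sum>j = 0..n div 2. int (n choose (2 * j)) * a ^ (2 * j) * f (n - 2 * j))"
    by (simp add: g_def sum_distrib_left algebra_simps)
  finally show ?thesis .
qed

lemma pcompose_power: "pcompose (p ^ n) r = pcompose p r ^ n" for p r :: "int poly"
  by (induction n) (simp_all add: pcompose_1 pcompose_mult)

lemma pcompose_shift_shift:
  "pcompose (pcompose q [:c, 1:]) [:d, 1:] = pcompose q [:c + d, 1:]" for q :: "int poly"
  by (simp add: pcompose_assoc [symmetric] pcompose_pCons)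

lemma umbral_gen_euler_symmetric_shift:
  "umbral (gen_euler a) (pcompose q [:a, 1:]) + umbral (gen_euler a) (pcompose q [:- a, 1:]) =
   2 * poly q (1 - a)"
proof -
  let ?L = "\<lambda>q. umbral (gen_euler a) (pcompose q [:a, 1:]) + umbral (gen_euler a) (pcompose q [:- a, 1:])"
  let ?f = "\<lambda>n. 2 * (1 - a) ^ n"
  have "?L q = umbral ?f q"
  proof (rule additive_eq_umbral [of ?L])
    fix n show "?L ([:0, 1:] ^ n) = ?f n"
      using umbral_power_shift_symmetric [of "gen_euler a" a n]
      by (simp add: pcompose_power pcompose_pCons gen_euler_recursion)
  qed (simp_all add: pcompose_add pcompose_smult umbral_add umbral_smult algebra_simps)
  also have "umbral ?f q = 2 * poly q (1 - a)"
    by (rule additive_eq_umbral [symmetric]) (simp_all add: algebra_simps)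
  finally show ?thesis .
qed

text \<open>Replacing q(x) by q(x + a) moves the evaluation point to 1, independently of
  \<open>a\<close>. This makes functionals for different parameters comparable.\<close>

lemma umbral_gen_euler_shift:
  "umbral (gen_euler a) (pcompose q [:2 * a, 1:]) + umbral (gen_euler a) q = 2 * poly q 1"
proof -
  have [simp]: "pcompose q [:0, 1:] = q" by simp
  show ?thesis
    using umbral_gen_euler_symmetric_shift [of a "pcompose q [:a, 1:]"]
    by (simp add: pcompose_shift_shift poly_pcompose del: pcompose_idR)
qed

text \<open>Applied to (x - a)^n, the shift equation becomes twice the defining recursion, which has
  only one solution.\<close>

lemma umbral_gen_euler_unique:
  fixes F :: "int poly \<Rightarrow> int"
  assumes add: "\<And>p q. F (p + q) = F p + F q"
    and smult: "\<And>c p. F (smult c p) = c * F p"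
    and shift: "\<And>q. F (pcompose q [:2 * a, 1:]) + F q = 2 * poly q 1"
  shows "F p = umbral (gen_euler a) p"
proof -
  define f where "f n = F ([:0, 1:] ^ n)" for n
  have F: "F p = umbral f p" for p
    by (rule additive_eq_umbral) (simp_all add: add smult f_def)
  have "f n = gen_euler a n" for n
  proof (rule gen_euler_unique)
    fix n
    have "2 * (\<Sum>j = 0..n div 2. int (n choose (2 * j)) * a ^ (2 * j) * f (n - 2 * j)) = 2 * (1 - a) ^ n"
      using shift [of "[:- a, 1:] ^ n"] umbral_power_shift_symmetric [of f a n]
      by (simp add: F pcompose_power pcompose_pCons)
    then show "(\<Sum>j = 0..n div 2. int (n choose (2 * j)) * a ^ (2 * j) * f (n - 2 * j)) = (1 - a) ^ n"
      by simp
  qed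
  then have "f = gen_euler a" by auto
  then show ?thesis by (simp add: F)
qed

section \<open>Distribution relation and divisibility by powers of 2\<close>

text \<open>An analogue of the multiplication formula for Euler polynomials. Under a shift by 2a the
  alternating sum telescopes to its two ends, which lie 2ac apart; as \<open>c\<close> is odd they
  add up, and the shift equation for parameter ac applies.\<close>

lemma umbral_gen_euler_distribution:
  assumes "odd c"
  shows "umbral (gen_euler a) p =
    (\<Sum>r<c. (- 1) ^ r * umbral (gen_euler (a * int c)) (pcompose p [:2 * a * int r, 1:]))"
proof -
  let ?G = "umbral (gen_euler (a * int c))"
  define F where "F p = (\<Sum>r<c. (- 1) ^ r * ?G (pcompose p [:2 * a * int r, 1:]))" for p
  have "F p = umbral (gen_euler a) p"
  proof (rule umbral_gen_euler_unique)
    fix q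
    define g where "g r = ?G (pcompose q [:2 * a * int r, 1:])" for r
    have "F (pcompose q [:2 * a, 1:]) + F q = (\<Sum>r<c. (- 1) ^ r * g r - (- 1) ^ Suc r * g (Suc r))"
      by (simp add: F_def g_def pcompose_shift_shift sum.distrib [symmetric] algebra_simps)
    also have "\<dots> = g 0 - (- 1) ^ c * g c"
      by (induction c) simp_all
    also have "\<dots> = 2 * poly q 1"
      using umbral_gen_euler_shift [of "a * int c" q] assms by (simp add: g_def mult.assoc)
    finally show "F (pcompose q [:2 * a, 1:]) + F q = 2 * poly q 1" .
  qed (simp_all add: F_def pcompose_add pcompose_smult umbral_add umbral_smult sum.distrib
        sum_distrib_left algebra_simps)
  then show ?thesis by (simp add: F_def)
qed

lemma gen_euler_cong:
  assumes "[a = c] (mod M)"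
  shows "[gen_euler a n = gen_euler c n] (mod M)"
proof (induction n rule: less_induct)
  case (less n)
  show ?case
    unfolding gen_euler.simps [of a n] gen_euler.simps [of c n]
    by (intro cong_diff cong_sum cong_mult cong_pow cong_refl assms less) auto
qed

lemma umbral_cong:
  assumes "\<And>n. [f n = g n] (mod M)"
  shows "[umbral f p = umbral g p] (mod M)"
  unfolding umbral_def by (intro cong_sum cong_mult cong_refl assms)

text \<open>For odd \<open>n\<close> the right side 0^n vanishes and the recursion involves only odd
  indices.\<close>

lemma gen_euler_1_odd: "odd n \<Longrightarrow> gen_euler 1 n = 0"
proof (induction n rule: less_induct)
  case (less n)
  have "gen_euler 1 (n - 2 * j) = 0" if "j \<in> {1..n div 2}" for j
    using that less.prems by (intro less.IH) auto
  then show ?case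
    using less.prems by (subst gen_euler.simps) (auto simp: power_0_left odd_pos)
qed

lemma umbral_gen_euler_1_odd:
  assumes "pcompose p [:0, - 1:] = - p"
  shows "umbral (gen_euler 1) p = 0"
proof -
  have "coeff p i = 0" if "even i" for i
    using arg_cong [OF assms, of "\<lambda>q. coeff q i"] that by (simp add: coeff_pcompose_linear)
  then show ?thesis
    unfolding umbral_def by (intro sum.neutral) (metis gen_euler_1_odd mult_eq_0_iff)
qed

text \<open>Modulo a power of 2, the distribution relation with \<open>c\<close> inverse to \<open>a\<close> reduces to the
  symmetric case \<open>a = 1\<close>, where odd polynomials are annihilated.\<close>

lemma dvd_umbral_gen_euler:
  assumes a: "odd a"
    and p: "pcompose p [:0, - 1:] = - p"
    and dvd: "\<And>z. odd z \<Longrightarrow> 2 ^ e dvd poly p z"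
  shows "2 ^ Suc e dvd umbral (gen_euler a) p"
proof -
  let ?M = "2 ^ Suc e :: int"
  have "coprime a ?M" using a by (simp add: coprime_right_2_iff_odd)
  then obtain x where x: "[a * x = 1] (mod ?M)"
    using cong_solve_coprime_int by blast
  \<comment> \<open>The inverse of \<open>a\<close> has to be a natural number because it counts the
    terms of the distribution relation.\<close>
  define c where "c = nat (x mod ?M)"
  have c: "int c = x mod ?M" by (simp add: c_def)
  have ac: "[a * int c = 1] (mod ?M)"
    using x unfolding c by (simp add: cong_def mod_mult_right_eq)
  have "odd c"
  proof -
    have "?M dvd a * int c - 1" using ac by (simp add: cong_iff_dvd_diff)
    then have "2 dvd a * int c - 1"
      by (rule dvd_trans [rotated]) simp
    then show ?thesis using a by simp
  qed
  let ?G = "umbral (gen_euler 1)"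
  \<comment> \<open>Oddness of \<open>p\<close> settles s = 0. Neighbouring shifts add up to twice a
    value of \<open>p\<close> at an odd integer, whence the extra factor 2. Both directions are
    required since s = ar may be negative.\<close>
  have G: "?M dvd ?G (pcompose p [:2 * s, 1:])" for s
  proof (induction s rule: int_induct [where k = 0])
    case base
    show ?case using umbral_gen_euler_1_odd [OF p] by simp
  next
    case (step1 s)
    have "?M dvd 2 * poly p (1 + 2 * s)"
      using dvd [of "1 + 2 * s"] by simp
    moreover have "?G (pcompose p [:2 * (s + 1), 1:]) + ?G (pcompose p [:2 * s, 1:]) = 2 * poly p (1 + 2 * s)"
      using umbral_gen_euler_shift [of 1 "pcompose p [:2 * s, 1:]"]
      by (simp add: pcompose_shift_shift poly_pcompose algebra_simps)
    ultimately show ?case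
      using step1(2) dvd_add_left_iff by metis
  next
    case (step2 s)
    have "?M dvd 2 * poly p (2 * s - 1)"
      using dvd [of "2 * s - 1"] by simp
    moreover have "?G (pcompose p [:2 * s, 1:]) + ?G (pcompose p [:2 * (s - 1), 1:]) = 2 * poly p (2 * s - 1)"
      using umbral_gen_euler_shift [of 1 "pcompose p [:2 * (s - 1), 1:]"]
      by (simp add: pcompose_shift_shift poly_pcompose algebra_simps)
    ultimately show ?case
      using step2(2) by (metis dvd_add_right_iff)
  qed
  have "[umbral (gen_euler (a * int c)) q = ?G q] (mod ?M)" for q
    by (rule umbral_cong, rule gen_euler_cong [OF ac])
  then have "?M dvd umbral (gen_euler (a * int c)) (pcompose p [:2 * s, 1:])" for s
    using G [of s] cong_dvd_iff by blast
  then show ?thesis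
    by (subst umbral_gen_euler_distribution [OF \<open>odd c\<close>])
       (intro dvd_sum dvd_mult, simp add: mult.assoc)
qed

lemma dvd_umbral_gen_euler_moment:
  assumes "odd a" "odd b"
  shows "2 ^ (3 * i + 1) dvd umbral (gen_euler a) ([:0, 1:] ^ b * [:- 1, 0, 1:] ^ i)"
proof -
  have "2 ^ (3 * i) dvd poly ([:0, 1:] ^ b * [:- 1, 0, 1:] ^ i) z" if "odd z" for z :: int
  proof -
    from that obtain c where "z = 2 * c + 1" by (elim oddE)
    moreover have "even (c * (c + 1))" by simp
    then obtain t where "c * (c + 1) = 2 * t" by (elim evenE)
    ultimately have "z * z - 1 = 2 ^ 3 * t" by (simp add: algebra_simps)
    then have "(2 ^ 3) ^ i dvd (z * z - 1) ^ i" by (intro dvd_power_same) simp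
    then show ?thesis by (simp add: power_mult)
  qed
  moreover have "pcompose ([:0, 1:] ^ b * [:- 1, 0, 1:] ^ i) [:0, - 1:] = - ([:0, 1:] ^ b * [:- 1, 0, 1:] ^ i :: int poly)"
  proof -
    have "[:0, - 1:] = - [:0, 1 :: int:]" by simp
    then have "[:0, - 1:] ^ b = - ([:0, 1 :: int:] ^ b)"
      using assms(2) by (metis power_minus_odd)
    then show ?thesis by (simp add: pcompose_mult pcompose_power pcompose_pCons)
  qed
  ultimately show ?thesis
    using dvd_umbral_gen_euler [OF assms(1)] by simp
qed

section \<open>Binomial expansions and their truncation\<close>

lemma umbral_mult_one_plus_power:
  "umbral f (p * (1 + w) ^ n) = (\<Sum>i\<le>n. int (n choose i) * umbral f (p * w ^ i))"
proof -
  have "p * (1 + w) ^ n = (\<Sum>i\<le>n. smult (int (n choose i)) (p * w ^ i))"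
    unfolding add.commute [of 1 w] binomial_ring
    by (simp add: sum_distrib_left of_nat_poly mult.left_commute)
  then show ?thesis by (simp add: umbral_sum umbral_smult)
qed

lemma binomial_sum_cong_truncate:
  fixes g :: "nat \<Rightarrow> int"
  assumes "\<And>i. r \<le> i \<Longrightarrow> M dvd int (n choose i) * g i"
  shows "[(\<Sum>i\<le>n. int (n choose i) * g i) = (\<Sum>i<r. int (n choose i) * g i)] (mod M)"
proof -
  \<comment> \<open>Padding with vanishing binomial coefficients treats n < r and r \<le> n
    alike.\<close>
  have "(\<Sum>i\<le>n. int (n choose i) * g i) = (\<Sum>i<r + Suc n. int (n choose i) * g i)"
    by (rule sum.mono_neutral_left) auto
  also have "\<dots> = (\<Sum>i<r. int (n choose i) * g i) + (\<Sum>i = r..<r + Suc n. int (n choose i) * g i)"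
    by (simp add: lessThan_atLeast0 sum.atLeastLessThan_concat)
  moreover have "M dvd (\<Sum>i = r..<r + Suc n. int (n choose i) * g i)"
    by (intro dvd_sum assms) simp
  ultimately show ?thesis
    by (simp add: cong_iff_dvd_diff)
qed

text \<open>From i * (N choose i) = N * (N - 1 choose i - 1), dividing by \<open>i\<close> costs at
  most its 2-part \<open>2 ^ u\<close>. The exponent 3i + 1 pays for this and for 11 more; at i = 4
  the balance is exact.\<close>

lemma pow2_dvd_binomial_mult:
  assumes "2 ^ v dvd N" "2 ^ (3 * i + 1) dvd A" "4 \<le> i"
  shows "2 ^ (v + 11) dvd int (N choose i) * A"
proof -
  obtain u q where i: "i = 2 ^ u * q" and q: "odd q"
  proof -
    have "i \<noteq> 0" "\<not> is_unit (2 :: nat)" using assms(3) by simp_all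
    then obtain q where "i = 2 ^ multiplicity 2 i * q" "odd q"
      by (rule multiplicity_decompose')
    then show ?thesis by (rule that)
  qed
  have "2 ^ v dvd i * (N choose i)"
    using assms times_binomial_minus1_eq [of i N] by simp
  then have "2 ^ v dvd (2 ^ u * (N choose i)) * q" by (simp add: i mult_ac)
  then have "2 ^ v dvd 2 ^ u * (N choose i)"
    using q by (subst (asm) coprime_dvd_mult_left_iff) simp_all
  then have "int (2 ^ v) dvd int (2 ^ u * (N choose i))" by (subst int_dvd_int_iff)
  then have C: "2 ^ v dvd 2 ^ u * int (N choose i)" by simp
  have "u + 11 \<le> 3 * i + 1"
  proof -
    have "2 ^ u \<le> i" using q assms(3) by (cases q) (auto simp: i)
    \<comment> \<open>Equality holds at i = 4; beyond that \<open>i\<close> is already at most the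
      exponent.\<close>
    also have "i \<le> 2 ^ (3 * i - 10)"
    proof (cases "i = 4")
      case False
      then have "i \<le> 3 * i - 10" using assms(3) by linarith
      then show ?thesis using less_exp [of "3 * i - 10"] by linarith
    qed simp
    finally show ?thesis using assms(3) by simp
  qed
  then have "(2 :: int) ^ (u + 11) dvd 2 ^ (3 * i + 1)" by (rule le_imp_power_dvd)
  then have "2 ^ (u + 11) dvd A" using assms(2) dvd_trans by blast
  then obtain B where "A = 2 ^ (u + 11) * B" by blast
  then have "int (N choose i) * A = (2 ^ u * int (N choose i)) * (2 ^ 11 * B)"
    by (simp add: power_add)
  also have "2 ^ (v + 11) dvd \<dots>"
    unfolding power_add by (intro mult_dvd_mono C) simp
  finally show ?thesis .
qed

section \<open>Explicit moments and reduction of the difference to them\<close>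

lemma gen_euler_small:
  "gen_euler a (Suc 0) = 1 - a"
  "gen_euler a 3 = 2 * a ^ 3 - 3 * a + 1"
  "gen_euler a 5 = - 16 * a ^ 5 + 20 * a ^ 3 - 5 * a + 1"
  "gen_euler a 7 = 272 * a ^ 7 - 336 * a ^ 5 + 70 * a ^ 3 - 7 * a + 1"
proof -
  have intervals: "{1..3 div 2} = {1::nat}" "{1..5 div 2} = {1, 2::nat}" "{1..7 div 2} = {1, 2, 3::nat}"
    by auto
  have binomials: "(3::nat) choose 2 = 3" "(5::nat) choose 2 = 10" "(5::nat) choose 4 = 5"
    "(7::nat) choose 2 = 21" "(7::nat) choose 4 = 35" "(7::nat) choose 6 = 7"
    by (simp_all add: numeral_eq_Suc)
  show 1: "gen_euler a (Suc 0) = 1 - a" by (subst gen_euler.simps) simp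
  show 3: "gen_euler a 3 = 2 * a ^ 3 - 3 * a + 1"
    by (subst gen_euler.simps, unfold intervals)
       (simp add: binomials 1, algebra)
  show 5: "gen_euler a 5 = - 16 * a ^ 5 + 20 * a ^ 3 - 5 * a + 1"
    by (subst gen_euler.simps, unfold intervals)
       (simp add: binomials 1 3, algebra)
  show 7: "gen_euler a 7 = 272 * a ^ 7 - 336 * a ^ 5 + 70 * a ^ 3 - 7 * a + 1"
    by (subst gen_euler.simps, unfold intervals)
       (simp add: binomials 1 3 5, algebra)
qed

text \<open>As polynomials in \<open>a\<close> these contain the factor a^2 - 1 = 8t, and the third
  also 17a^2 - 1 = 8(2 + 17t). Using \<open>t\<close> exposes the factors 2^4, 2^7 and 2^10.\<close>

lemma umbral_gen_euler_moments:
  fixes a t :: int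
  assumes "a ^ 2 = 1 + 8 * t"
  shows "umbral (gen_euler a) ([:0, 1:] * [:- 1, 0, 1:] ^ 1) = 16 * a * t"
    and "umbral (gen_euler a) ([:0, 1:] * [:- 1, 0, 1:] ^ 2) = - 128 * a ^ 3 * t"
    and "umbral (gen_euler a) ([:0, 1:] * [:- 1, 0, 1:] ^ 3) = 1024 * a ^ 3 * t * (2 + 17 * t)"
proof -
  have poly: "[:0, 1:] * [:- 1, 0, 1:] ^ 1 = [:0, - 1, 0, 1 :: int:]"
    "[:0, 1:] * [:- 1, 0, 1:] ^ 2 = [:0, 1, 0, - 2, 0, 1 :: int:]"
    "[:0, 1:] * [:- 1, 0, 1:] ^ 3 = [:0, - 1, 0, 3, 0, - 3, 0, 1 :: int:]"
    by (simp_all add: power2_eq_square power3_eq_cube)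
  note expand = umbral_pCons gen_euler_small numeral_3_eq_3 [symmetric]
  have 1: "umbral (gen_euler a) [:0, - 1, 0, 1:] = 2 * a ^ 3 - 2 * a"
    by (simp add: expand)
  have 2: "umbral (gen_euler a) [:0, 1, 0, - 2, 0, 1:] = 16 * a ^ 3 - 16 * a ^ 5"
    by (simp add: expand)
  have 3: "umbral (gen_euler a) [:0, - 1, 0, 3, 0, - 3, 0, 1:] = 16 * a ^ 3 - 288 * a ^ 5 + 272 * a ^ 7"
    by (simp add: expand)
  show "umbral (gen_euler a) ([:0, 1:] * [:- 1, 0, 1:] ^ 1) = 16 * a * t"
    unfolding poly 1 using assms by algebra
  show "umbral (gen_euler a) ([:0, 1:] * [:- 1, 0, 1:] ^ 2) = - 128 * a ^ 3 * t"
    unfolding poly 2 using assms by algebra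
  show "umbral (gen_euler a) ([:0, 1:] * [:- 1, 0, 1:] ^ 3) = 1024 * a ^ 3 * t * (2 + 17 * t)"
    unfolding poly 3 using assms by algebra
qed

text \<open>Expanding x^(2h) = (1 + w)^h raises the order of the moment, and orders from 4 on are
  divisible by \<open>2 ^ 13\<close>.\<close>

lemma umbral_gen_euler_moment_cong:
  fixes a :: int
  assumes "odd a"
  defines "M \<equiv> \<lambda>i. umbral (gen_euler a) ([:0, 1:] * [:- 1, 0, 1:] ^ i)"
  shows "[umbral (gen_euler a) ([:0, 1:] ^ (2 * h + 1) * [:- 1, 0, 1:] ^ i) =
    (\<Sum>s<4 - i. int (h choose s) * M (i + s))] (mod 2 ^ 13)"
proof -
  have "[:0, 1:] ^ (2 * h + 1) = [:0, 1:] * (1 + [:- 1, 0, 1 :: int:]) ^ h"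
    by (simp add: power_mult power2_eq_square one_pCons)
  then have "umbral (gen_euler a) ([:0, 1:] ^ (2 * h + 1) * [:- 1, 0, 1:] ^ i) =
      umbral (gen_euler a) (([:0, 1:] * [:- 1, 0, 1:] ^ i) * (1 + [:- 1, 0, 1 :: int:]) ^ h)"
    by (simp only: mult_ac)
  also have "\<dots> = (\<Sum>s\<le>h. int (h choose s) * M (i + s))"
    by (subst umbral_mult_one_plus_power) (simp only: M_def power_add mult.assoc)
  also have "[\<dots> = (\<Sum>s<4 - i. int (h choose s) * M (i + s))] (mod 2 ^ 13)"
  proof (rule binomial_sum_cong_truncate)
    fix s assume "4 - i \<le> s"
    then have "(2 :: int) ^ 13 dvd 2 ^ (3 * (i + s) + 1)" by (intro le_imp_power_dvd) simp
    also have "\<dots> dvd M (i + s)"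
      using dvd_umbral_gen_euler_moment [OF assms(1) odd_one, of "i + s"]
      by (simp only: M_def power_one_right)
    finally show "2 ^ 13 dvd int (h choose s) * M (i + s)" by (rule dvd_mult)
  qed
  finally show ?thesis .
qed

text \<open>Since x^2 = 1 + w, the binomial exponent is half the index difference. The application
  takes v = m - 1, so that v + 11 = m + 10.\<close>

lemma gen_euler_diff_cong:
  assumes "odd a" "odd b" "2 ^ v dvd N"
  defines "A \<equiv> \<lambda>i. umbral (gen_euler a) ([:0, 1:] ^ b * [:- 1, 0, 1:] ^ i)"
  shows "[gen_euler a (2 * N + b) - gen_euler a b =
    int N * A 1 + int (N choose 2) * A 2 + int (N choose 3) * A 3] (mod 2 ^ (v + 11))"
proof -
  have "[:0, 1:] ^ (2 * N + b) = [:0, 1:] ^ b * (1 + [:- 1, 0, 1 :: int:]) ^ N"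
    by (simp add: power_add power_mult power2_eq_square one_pCons)
  then have "gen_euler a (2 * N + b) = (\<Sum>i\<le>N. int (N choose i) * A i)"
    by (simp only: umbral_power [symmetric] umbral_mult_one_plus_power A_def)
  also have "[\<dots> = (\<Sum>i<4. int (N choose i) * A i)] (mod 2 ^ (v + 11))"
    unfolding A_def using assms
    by (intro binomial_sum_cong_truncate pow2_dvd_binomial_mult dvd_umbral_gen_euler_moment)
  finally have "[gen_euler a (2 * N + b) - A 0 = (\<Sum>i<4. int (N choose i) * A i) - A 0] (mod 2 ^ (v + 11))"
    by (intro cong_diff cong_refl)
  moreover have "A 0 = gen_euler a b" by (simp add: A_def umbral_power)
  ultimately show ?thesis by (simp add: eval_nat_numeral add_ac)
qed

section \<open>Comparison with the stated coefficient\<close>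

lemma two_binomial_2: "2 * int (n choose 2) = int n * (int n - 1)"
  by (induction n) (simp_all add: numeral_2_eq_2 algebra_simps)

lemma six_binomial_3: "6 * int (n choose 3) = int n * (int n - 1) * (int n - 2)"
proof (induction n)
  case (Suc n)
  then show ?case
    using two_binomial_2 [of n] by (simp add: numeral_3_eq_3 numeral_2_eq_2 algebra_simps)
qed simp

text \<open>In N A1 + (N choose 2) A2 + (N choose 3) A3 the moments' contribution linear in N is A1
  - A2/2 + A3/3. Three times this, with the explicit moments inserted, is compared with 6P, where P
  is the part of the stated coefficient free of \<open>m\<close>.\<close>

lemma main_coefficient_cong:
  fixes a t c h q :: int
  assumes c: "a = 2 * c + 1" and t: "a ^ 2 = 1 + 8 * t" and q: "2 * q = h * (h - 1)"
  shows "2 ^ 11 dvd 3 * (16 * a * t - 128 * (a ^ 3 * t) * h + 1024 * q * (a ^ 3 * t) * (2 + 17 * t))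
    + 3 * (64 * (a ^ 3 * t) - 512 * h * (a ^ 3 * t) * (2 + 17 * t)) + 1024 * (a ^ 3 * t) * (2 + 17 * t)
    - 6 * ((17 * a ^ 7 + 162 * a ^ 5 + 153 * a ^ 3 + 64 * a ^ 2 + 180 * a + 192) * (2 * h + 1) ^ 2
         - (102 * a ^ 7 + 216 * a ^ 5 + 386 * a ^ 3 - 704 * a) * (2 * h + 1)
         - (211 * a ^ 7 - 10 * a ^ 5 - 32 * a ^ 4 + 66 * a ^ 3 - 267 * a - 224))" (is "_ dvd ?W")
proof -
  have pow: "a ^ 3 = a * (1 + 8 * t)" "a ^ 4 = (1 + 8 * t) ^ 2" "a ^ 5 = a * (1 + 8 * t) ^ 2"
    "a ^ 7 = a * (1 + 8 * t) ^ 3"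
    unfolding t [symmetric] by (simp_all add: eval_nat_numeral)
  have q': "1024 * q * x = 512 * (h * (h - 1)) * x" for x
    unfolding q [symmetric] by simp
  have "?W = 2 ^ 11 * (- 3 * h - 3 * h ^ 2 - 3 * t - 6 * t * h - 6 * t * h ^ 2 - 6 * t ^ 2
      + a * (- 6 * h - 6 * h ^ 2 + 31 * t - 48 * t * h ^ 2 + 192 * t ^ 2 - 15 * t ^ 2 * h
        - 135 * t ^ 2 * h ^ 2 + 512 * t ^ 3)) - 3072 * (a + 1)"
    unfolding q' pow t by (simp add: algebra_simps power2_eq_square power3_eq_cube)
  \<comment> \<open>3072 is only 3 * 2^10; the evenness of a + 1 supplies the missing factor
    2.\<close>
  also have "3072 * (a + 1) = 2 ^ 11 * (3 * (c + 1))" by (simp add: c)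
  finally show ?thesis by (simp only: right_diff_distrib [symmetric] dvd_triv_left)
qed

theorem theorem2p3:
  fixes a :: int and k m b :: nat
  assumes "odd a" and "k > 0" and "m \<ge> 5" and "odd b"
  shows "[gen_euler a (2 ^ m * k + b) - gen_euler a b =
      2 ^ m * int k *
        ((17 * a ^ 7 + 162 * a ^ 5 + 153 * a ^ 3 + 64 * a ^ 2 + 180 * a + 192) * (int b) ^ 2
         - (102 * a ^ 7 + 216 * a ^ 5 + 386 * a ^ 3 - 704 * a) * int b
         - (211 * a ^ 7 - 10 * a ^ 5 - 32 * a ^ 4 + 66 * a ^ 3 - 267 * a - 224)
         + 2 ^ (m + 1) * (a ^ 2 - 1))] (mod 2 ^ (m + 10))"
proof -
  obtain h where b: "b = 2 * h + 1" using assms(4) by (elim oddE)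
  obtain c where c: "a = 2 * c + 1" using assms(1) by (elim oddE)
  have "even (c * (c + 1))" by simp
  then obtain t where "c * (c + 1) = 2 * t" by (elim evenE)
  then have t: "a ^ 2 = 1 + 8 * t" by (simp add: c power2_eq_square algebra_simps)
  obtain n where m: "m = 5 + n" using assms(3) le_Suc_ex by blast
  \<comment> \<open>With e = 2^(m - 5) the modulus is \<open>2 ^ 15 * e\<close>, and the correction
    \<open>2 ^ (m + 1) * (a ^ 2 - 1)\<close> is \<open>64 * e * (8 * t)\<close>.\<close>
  define e :: int where "e = 2 ^ n"
  define y where "y = e * int k"
  define N where "N = 2 ^ (n + 4) * k"
  have N: "int N = 16 * y" by (simp add: N_def y_def e_def power_add)
  define A where "A i = umbral (gen_euler a) ([:0, 1:] ^ b * [:- 1, 0, 1:] ^ i)" for i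
  define P where "P = (17 * a ^ 7 + 162 * a ^ 5 + 153 * a ^ 3 + 64 * a ^ 2 + 180 * a + 192) * (int b) ^ 2
         - (102 * a ^ 7 + 216 * a ^ 5 + 386 * a ^ 3 - 704 * a) * int b
         - (211 * a ^ 7 - 10 * a ^ 5 - 32 * a ^ 4 + 66 * a ^ 3 - 267 * a - 224)"
  define q where "q = int (h choose 2)"
  define s where "s = a ^ 3 * t"
  define g where "g = 2 + 17 * t"
  define M where "M i = umbral (gen_euler a) ([:0, 1:] * [:- 1, 0, 1:] ^ i)" for i
  note M = umbral_gen_euler_moments [OF t, folded M_def]
  note A_cong = umbral_gen_euler_moment_cong [OF assms(1), of h, folded b, folded A_def M_def]
  have sum2: "(\<Sum>i<2. f i) = f 0 + f 1" and sum3: "(\<Sum>i<3. f i) = f 0 + f 1 + f 2"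
    for f :: "nat \<Rightarrow> int"
    by (simp_all add: numeral_2_eq_2 numeral_3_eq_3)
  have "[A 1 = M 1 + int h * M 2 + q * M 3] (mod 2 ^ 13)"
    using A_cong [of 1] by (simp add: sum3 q_def flip: numeral_2_eq_2)
  then have "2 ^ 13 dvd A 1 - (M 1 + int h * M 2 + q * M 3)" by (simp only: cong_iff_dvd_diff)
  then obtain z1 where "A 1 - (M 1 + int h * M 2 + q * M 3) = 2 ^ 13 * z1" ..
  then have A1: "A 1 = 16 * a * t - 128 * s * int h + 1024 * q * s * g + 2 ^ 13 * z1"
    unfolding M by (simp add: s_def g_def algebra_simps)
  have "[A 2 = M 2 + int h * M 3] (mod 2 ^ 13)"
    using A_cong [of 2] by (simp add: sum2 flip: numeral_2_eq_2)
  then have "2 ^ 13 dvd A 2 - (M 2 + int h * M 3)" by (simp only: cong_iff_dvd_diff)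
  then obtain z2 where "A 2 - (M 2 + int h * M 3) = 2 ^ 13 * z2" ..
  then have A2: "A 2 = - 128 * s + 1024 * int h * s * g + 2 ^ 13 * z2"
    unfolding M by (simp add: s_def g_def algebra_simps)
  have "[A 3 = M 3] (mod 2 ^ 13)"
    using A_cong [of 3] by simp
  then have "2 ^ 13 dvd A 3 - M 3" by (simp only: cong_iff_dvd_diff)
  then obtain z3 where "A 3 - M 3 = 2 ^ 13 * z3" ..
  then have A3: "A 3 = 1024 * s * g + 2 ^ 13 * z3"
    unfolding M by (simp add: s_def g_def algebra_simps)
  have C2: "int (N choose 2) = 8 * y * (16 * y - 1)"
    using two_binomial_2 [of N] by (simp add: N)
  have C3: "3 * int (N choose 3) = 16 * y * (16 * y - 1) * (8 * y - 1)"
    using six_binomial_3 [of N] by (simp add: N algebra_simps)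
  have int_b: "int b = 2 * int h + 1" by (simp add: b)
  have "2 ^ 11 dvd 3 * (16 * a * t - 128 * s * int h + 1024 * q * s * g)
      + 3 * (64 * s - 512 * int h * s * g) + 1024 * s * g - 6 * P"
    unfolding s_def g_def q_def P_def int_b by (rule main_coefficient_cong [OF c t two_binomial_2])
  then obtain w where w: "3 * (16 * a * t - 128 * s * int h + 1024 * q * s * g)
      + 3 * (64 * s - 512 * int h * s * g) + 1024 * s * g - 6 * P = 2 ^ 11 * w" ..
  \<comment> \<open>The y^2 term from -128s in \<open>A 2\<close> and the \<open>m\<close>-dependent
    correction combine to -3 * 2^14 * y(ys + et). This parity gives the last factor 2.\<close>
  have "even (int k * (int k * a ^ 3 + 1))" using assms(1) by simp
  then obtain r where r: "int k * (int k * a ^ 3 + 1) = 2 * r" by (elim evenE)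
  define D where "D = int N * A 1 + int (N choose 2) * A 2 + int (N choose 3) * A 3"
  \<comment> \<open>\<open>Z\<close> gathers the errors \<open>z1\<close>, \<open>z2\<close>,
    \<open>z3\<close> and the remaining terms of higher degree in \<open>y\<close>, after removal of
    16y * 2^11.\<close>
  define Z where "Z = 12 * z1 + 12 * y * int h * s * g + 96 * y * z2 - 6 * z2 + 4 * z3
      + (64 * y ^ 2 - 12 * y) * (s * g + 8 * z3)"
  \<comment> \<open>The factor 3 clears the denominator of \<open>N choose 3\<close>; it is coprime
    to the modulus and is cancelled at the end.\<close>
  have "3 * (D - 32 * y * (P + 64 * e * (8 * t))) =
      48 * y * A 1 + 24 * y * (16 * y - 1) * A 2 + (3 * int (N choose 3)) * A 3 - 96 * y * (P + 64 * e * (8 * t))"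
    by (simp add: D_def N C2 algebra_simps)
  also have "\<dots> = 16 * y * (2 ^ 11 * w + 2 ^ 11 * Z) - 3 * 2 ^ 14 * (y * (y * s + e * t))"
    unfolding C3 w [symmetric] A1 A2 A3 Z_def
    by (simp add: algebra_simps power2_eq_square)
  also have "y * (y * s + e * t) = e ^ 2 * t * (int k * (int k * a ^ 3 + 1))"
    by (simp add: y_def s_def algebra_simps power2_eq_square)
  also have "\<dots> = e ^ 2 * t * (2 * r)" unfolding r ..
  also have "16 * y * (2 ^ 11 * w + 2 ^ 11 * Z) - 3 * 2 ^ 14 * (e ^ 2 * t * (2 * r)) =
      2 ^ 15 * e * (int k * (w + Z) - 3 * e * t * r)"
    unfolding y_def by (simp add: algebra_simps power2_eq_square)
  finally have "2 ^ 15 * e dvd 3 * (D - 32 * y * (P + 64 * e * (8 * t)))" ..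
  moreover have "coprime (2 ^ 15 * e) 3"
    unfolding e_def power_add [symmetric] by (simp add: coprime_left_2_iff_odd)
  ultimately have "2 ^ 15 * e dvd D - 32 * y * (P + 64 * e * (8 * t))"
    by (simp only: coprime_dvd_mult_right_iff)
  then have "[D = 32 * y * (P + 64 * e * (8 * t))] (mod 2 ^ (m + 10))"
    by (simp add: cong_iff_dvd_diff m e_def power_add)
  moreover have "[gen_euler a (2 * N + b) - gen_euler a b = D] (mod 2 ^ (n + 4 + 11))"
    unfolding D_def A_def by (rule gen_euler_diff_cong) (use assms in \<open>auto simp: N_def\<close>)
  moreover have "n + 4 + 11 = m + 10" by (simp add: m)
  ultimately have "[gen_euler a (2 * N + b) - gen_euler a b = 32 * y * (P + 64 * e * (8 * t))] (mod 2 ^ (m + 10))"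
    by (metis cong_trans)
  moreover have "2 ^ m * k = 2 * N" "2 ^ m * int k = 32 * y" "2 ^ (m + 1) * (a ^ 2 - 1) = 64 * e * (8 * t)"
    by (simp_all add: m N_def y_def e_def t power_add)
  ultimately show ?thesis
    unfolding P_def [symmetric] by (simp only:)
qed

end
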